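(* Let $\mathcal{T}$ be a binary tree with leaves $\mathcal{L}=\{1,\dots,n\}$, let $V_1,\dots,V_n$ be finite-dimensional complex vector spaces attached to the leaves, and let $f:\mathcal{E}(\mathcal{T})\to\mathbb{N}$ be a function defining the variety $\mathrm{TNS}(\mathcal{T},f)$. Let $\mathcal{A}\subset\mathcal{L}$ and let $\mathcal{M}\subset\mathcal{E}(\mathcal{T})$ be a monochromatic cut, i.e. a set of edges such that after removing them from $\mathcal{T}$ every tree of the resulting forest has all its leaves either in $\mathcal{A}$ or in $\mathcal{L}\setminus\mathcal{A}$. Then for every $t\in\mathrm{TNS}(\mathcal{T},f)$, \[ \dim\Big(\big(\textstyle\bigotimes_{l\in\mathcal{A}}V_l\big)^*\lrcorner\, t\Big)\le \prod_{e\in\mathcal{M}} f(e). \]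
   Context: A binary tree here is an (unrooted) tree all of whose non-leaf vertices have degree 3. For an edge $e$, removing $e$ splits $\mathcal{T}$ into two trees; $\overleftarrow{e}$ denotes the set of leaves of one of them (by symmetry of flattening rank the choice does not matter). For $B\subset\mathcal{L}$ and $t\in V_1\otimes\dots\otimes V_n$, $(\bigotimes_{l\in B}V_l)^*\lrcorner\, t\subset\bigotimes_{l\notin B}V_l$ is the image of the contraction map $(\bigotimes_{l\in B}V_l)^*\to\bigotimes_{l\notin B}V_l$ induced by $t$; its dimension is the flattening rank of $t$ with respect to $B$. The variety of tensor network states is $\mathrm{TNS}(\mathcal{T},f)=\{t\in V_1\otimes\dots\otimes V_n : \dim((\bigotimes_{l\in\overleftarrow{e}}V_l)^*\lrcorner\, t)\le f(e)\text{ for all } e\in\mathcal{E}(\mathcal{T})\}$. *)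

theory Defs
  imports Complex_Main "HOL-Library.FuncSet" "HOL-Library.Function_Algebras"
begin

section \<open>Trees\<close>

text \<open>
  Simple graphs are given by a vertex set \<open>X\<close> and a set \<open>E\<close> of two-element subsets of \<open>X\<close>.
  The notion \<open>tree\<close> of the AFP entry Graph-Theory forbids only directed cycles, hence is not
  the usual one for undirected graphs, and trees are defined here from scratch.
\<close>

definition adj :: "'a set set \<Rightarrow> ('a \<times> 'a) set" where
  "adj E = {(u, v). {u, v} \<in> E}"

definition component :: "'a set set \<Rightarrow> 'a \<Rightarrow> 'a set" where
  "component E v = {w. (v, w) \<in> (adj E)\<^sup>*}"

definition is_cycle :: "'a set set \<Rightarrow> 'a list \<Rightarrow> bool" where
  "is_cycle E vs \<longleftrightarrow> 3 \<le> length vs \<and> distinct vs \<and>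
     (\<forall>i < length vs. {vs ! i, vs ! (Suc i mod length vs)} \<in> E)"

definition is_tree :: "'a set \<Rightarrow> 'a set set \<Rightarrow> bool" where
  "is_tree X E \<longleftrightarrow> finite X \<and> X \<noteq> {} \<and> (\<forall>e\<in>E. e \<subseteq> X \<and> card e = 2) \<and>
     (\<forall>u\<in>X. \<forall>v\<in>X. v \<in> component E u) \<and> (\<nexists>vs. is_cycle E vs)"

definition degree :: "'a set set \<Rightarrow> 'a \<Rightarrow> nat" where
  "degree E v = card {e \<in> E. v \<in> e}"

text \<open>In a tree with at least two vertices the leaves are the vertices of degree 1; allowing
  degree 0 makes the vertex of the one-vertex tree a leaf (the case \<open>n = 1\<close>).\<close>

definition leaves :: "'a set \<Rightarrow> 'a set set \<Rightarrow> 'a set" where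
  "leaves X E = {v \<in> X. degree E v \<le> 1}"

definition binary_tree :: "'a set \<Rightarrow> 'a set set \<Rightarrow> bool" where
  "binary_tree X E \<longleftrightarrow> is_tree X E \<and> (\<forall>v \<in> X - leaves X E. degree E v = 3)"

text \<open>The leaves on one side of an edge \<open>e\<close>, namely the side of its endpoint \<open>v\<close>.\<close>

definition side_leaves :: "'a set \<Rightarrow> 'a set set \<Rightarrow> 'a set \<Rightarrow> 'a \<Rightarrow> 'a set" where
  "side_leaves X E e v = leaves X E \<inter> component (E - {e}) v"

text \<open>The leaves of a tree of the forest are those leaves of the original tree that it contains;
  vertices that become end points only by removing edges do not count.\<close>

definition monochromatic_cut :: "'a set \<Rightarrow> 'a set set \<Rightarrow> 'a set \<Rightarrow> 'a set set \<Rightarrow> bool" where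
  "monochromatic_cut X E A M \<longleftrightarrow> M \<subseteq> E \<and>
     (\<forall>v\<in>X. leaves X E \<inter> component (E - M) v \<subseteq> A \<or>
            leaves X E \<inter> component (E - M) v \<subseteq> leaves X E - A)"

section \<open>Tensors\<close>

text \<open>
  The spaces \<open>V l\<close> are finite-dimensional subspaces of an arbitrary complex vector space
  \<open>(scale, 'v)\<close>. Every family of complex vector spaces arises this way up to isomorphism,
  for instance inside its direct sum.
\<close>

definition findim_subspace :: "(complex \<Rightarrow> 'v \<Rightarrow> 'v) \<Rightarrow> 'v::ab_group_add set \<Rightarrow> bool" where
  "findim_subspace scale S \<longleftrightarrow> (\<exists>B. finite B \<and> module.span scale B = S)"

text \<open>Linear functionals on a subspace \<open>S\<close>, extended by \<open>0\<close> outside of \<open>S\<close> to make them unique.\<close>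

definition dual_space :: "(complex \<Rightarrow> 'v \<Rightarrow> 'v) \<Rightarrow> 'v::ab_group_add set \<Rightarrow> ('v \<Rightarrow> complex) set" where
  "dual_space scale S = {\<phi>.
     (\<forall>x\<in>S. \<forall>y\<in>S. \<phi> (x + y) = \<phi> x + \<phi> y) \<and>
     (\<forall>c. \<forall>x\<in>S. \<phi> (scale c x) = c * \<phi> x) \<and>
     (\<forall>x. x \<notin> S \<longrightarrow> \<phi> x = 0)}"

definition fun_scale :: "complex \<Rightarrow> ('x \<Rightarrow> complex) \<Rightarrow> 'x \<Rightarrow> complex" where
  "fun_scale c f = (\<lambda>x. c * f x)"

lemma vector_space_fun_scale: "vector_space fun_scale"
  by unfold_locales (auto simp: fun_scale_def algebra_simps)

type_synonym ('l, 'v) tensor = "('l \<Rightarrow> 'v \<Rightarrow> complex) \<Rightarrow> complex"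

definition covectors ::
  "(complex \<Rightarrow> 'v \<Rightarrow> 'v) \<Rightarrow> ('l \<Rightarrow> 'v::ab_group_add set) \<Rightarrow> 'l set \<Rightarrow> ('l \<Rightarrow> 'v \<Rightarrow> complex) set" where
  "covectors scale V K = (\<Pi>\<^sub>E l\<in>K. dual_space scale (V l))"

text \<open>
  The tensor product of the finite-dimensional spaces \<open>V l\<close>, \<open>l \<in> K\<close>, realised as the space of
  multilinear forms on the product of their duals: the pure tensor of vectors \<open>v l\<close> is the form
  \<open>\<phi> \<mapsto> (\<Prod>l\<in>K. \<phi> l (v l))\<close>. Forms are extended by \<open>0\<close> to make them unique.
\<close>

definition tensor_space ::
  "(complex \<Rightarrow> 'v \<Rightarrow> 'v) \<Rightarrow> ('l \<Rightarrow> 'v::ab_group_add set) \<Rightarrow> 'l set \<Rightarrow> ('l, 'v) tensor set" where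
  "tensor_space scale V K = {t.
     (\<forall>\<phi> \<in> covectors scale V K. \<forall>l\<in>K. \<forall>a \<in> dual_space scale (V l). \<forall>b \<in> dual_space scale (V l).
        t (\<phi>(l := a + b)) = t (\<phi>(l := a)) + t (\<phi>(l := b))) \<and>
     (\<forall>\<phi> \<in> covectors scale V K. \<forall>l\<in>K. \<forall>a \<in> dual_space scale (V l). \<forall>c.
        t (\<phi>(l := fun_scale c a)) = c * t (\<phi>(l := a))) \<and>
     (\<forall>\<phi>. \<phi> \<notin> covectors scale V K \<longrightarrow> t \<phi> = 0)}"

text \<open>
  Contraction of \<open>t\<close> in the tensor product over \<open>K\<close> with a functional \<open>\<psi>\<close> on the tensor product
  over \<open>B \<subseteq> K\<close>: fixing the covectors at \<open>K - B\<close> turns \<open>t\<close> into a tensor over \<open>B\<close>, to which \<open>\<psi>\<close>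
  is applied.
\<close>

definition contract ::
  "(complex \<Rightarrow> 'v \<Rightarrow> 'v) \<Rightarrow> ('l \<Rightarrow> 'v::ab_group_add set) \<Rightarrow> 'l set \<Rightarrow> 'l set \<Rightarrow>
   (('l, 'v) tensor \<Rightarrow> complex) \<Rightarrow> ('l, 'v) tensor \<Rightarrow> ('l, 'v) tensor" where
  "contract scale V K B \<psi> t = (\<lambda>\<phi>.
     if \<phi> \<in> covectors scale V (K - B)
     then \<psi> (\<lambda>\<chi>. if \<chi> \<in> covectors scale V B then t (override_on \<phi> \<chi> B) else 0)
     else 0)"

definition flattening_image ::
  "(complex \<Rightarrow> 'v \<Rightarrow> 'v) \<Rightarrow> ('l \<Rightarrow> 'v::ab_group_add set) \<Rightarrow> 'l set \<Rightarrow> 'l set \<Rightarrow>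
   ('l, 'v) tensor \<Rightarrow> ('l, 'v) tensor set" where
  "flattening_image scale V K B t =
     (\<lambda>\<psi>. contract scale V K B \<psi> t) ` dual_space fun_scale (tensor_space scale V B)"

definition flattening_rank ::
  "(complex \<Rightarrow> 'v \<Rightarrow> 'v) \<Rightarrow> ('l \<Rightarrow> 'v::ab_group_add set) \<Rightarrow> 'l set \<Rightarrow> 'l set \<Rightarrow>
   ('l, 'v) tensor \<Rightarrow> nat" where
  "flattening_rank scale V K B t = vector_space.dim fun_scale (flattening_image scale V K B t)"

text \<open>The function \<open>tail\<close> chooses an endpoint of every edge, and thereby the side of the edge
  whose leaves are used for the flattening.\<close>

definition TNS ::
  "(complex \<Rightarrow> 'v \<Rightarrow> 'v) \<Rightarrow> ('a \<Rightarrow> 'v::ab_group_add set) \<Rightarrow> 'a set \<Rightarrow> 'a set set \<Rightarrow>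
   ('a set \<Rightarrow> 'a) \<Rightarrow> ('a set \<Rightarrow> nat) \<Rightarrow> ('a, 'v) tensor set" where
  "TNS scale V X E tail f = {t \<in> tensor_space scale V (leaves X E).
     \<forall>e\<in>E. flattening_rank scale V (leaves X E) (side_leaves X E e (tail e)) t \<le> f e}"

end

theory Submission
  imports Defs "HOL-Library.Transitive_Closure_Table"
begin

text \<open>
  A flattening rank is the minimal number of terms in a separation of \<open>t\<close>, as a function of
  covectors, into products of a function of the covectors in \<open>B\<close> and one of the others. Hence it is
  invariant under complements and submultiplicative: if \<open>B\<close> lies inside or outside of \<open>A\<close>, and
  \<open>A'\<close> agrees with \<open>A\<close> off \<open>B\<close>, then the rank for \<open>A\<close> is at most the product of those for \<open>B\<close>
  and \<open>A'\<close>. The cut is removed one edge at a time, always choosing an edge \<open>e\<close> that has no other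
  edge of the cut on one of its sides. This side is monochromatic; recolouring it to the colour of
  the other endpoint of \<open>e\<close> makes the cut without \<open>e\<close> monochromatic and costs the factor \<open>f e\<close>.
\<close>

section \<open>Separation rank\<close>

interpretation fs: vector_space fun_scale
  by (rule vector_space_fun_scale)

lemma sum_fun_app: "(\<Sum>i\<in>I. F i) x = (\<Sum>i\<in>I. F i x)" for F :: "'i \<Rightarrow> 'b \<Rightarrow> complex"
  by (induction I rule: infinite_finite_induct) auto

text \<open>An upper bound for the rank of the matrix whose rows are indexed by the coordinates in
  \<open>B\<close> and whose columns by the remaining ones. The factors are arbitrary functions, so
  coordinates can be frozen and regrouped freely.\<close>

definition sep_rank_le ::
  "'l set \<Rightarrow> ('l \<Rightarrow> 'b set) \<Rightarrow> (('l \<Rightarrow> 'b) \<Rightarrow> complex) \<Rightarrow> 'l set \<Rightarrow> nat \<Rightarrow> bool" where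
  "sep_rank_le L D t B r \<longleftrightarrow> (\<exists>g h. \<forall>x\<in>Pi\<^sub>E L D.
     t x = (\<Sum>i<r. g i (restrict x B) * h i (restrict x (L - B))))"

lemma sep_rank_leI:
  assumes "finite I" "card I \<le> r"
    and t: "\<And>x. x \<in> Pi\<^sub>E L D \<Longrightarrow>
      t x = (\<Sum>i\<in>I. g i (restrict x B) * h i (restrict x (L - B)))"
  shows "sep_rank_le L D t B r"
proof -
  obtain k where k: "bij_betw k {..<card I} I"
    using assms(1) ex_bij_betw_nat_finite atLeast0LessThan by metis
  \<comment> \<open>Zero factors pad the sum from \<open>card I\<close> to exactly \<open>r\<close>
    terms.\<close>
  let ?g = "\<lambda>i y. if i < card I then g (k i) y else 0"
  have "t x = (\<Sum>i<r. ?g i (restrict x B) * h (k i) (restrict x (L - B)))" if "x \<in> Pi\<^sub>E L D" for x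
  proof -
    have "t x = (\<Sum>i<card I. g (k i) (restrict x B) * h (k i) (restrict x (L - B)))"
      unfolding t[OF that] by (rule sum.reindex_bij_betw[OF k, symmetric])
    also have "\<dots> = (\<Sum>i<r. ?g i (restrict x B) * h (k i) (restrict x (L - B)))"
      by (rule sum.mono_neutral_cong_left) (use assms(2) in auto)
    finally show ?thesis .
  qed
  then show ?thesis
    unfolding sep_rank_le_def by (intro exI[of _ ?g] exI[of _ "\<lambda>i. h (k i)"]) simp
qed

lemma sep_rank_le_mono:
  assumes "sep_rank_le L D t B r" "r \<le> q"
  shows "sep_rank_le L D t B q"
proof -
  obtain g h where "\<And>x. x \<in> Pi\<^sub>E L D \<Longrightarrow>
      t x = (\<Sum>i<r. g i (restrict x B) * h i (restrict x (L - B)))"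
    using assms unfolding sep_rank_le_def by blast
  then show ?thesis using assms(2) by (intro sep_rank_leI[of "{..<r}"]) simp_all
qed

lemma sep_rank_le_compl:
  assumes "sep_rank_le L D t B r" "B \<subseteq> L"
  shows "sep_rank_le L D t (L - B) r"
proof -
  obtain g h where *: "\<And>x. x \<in> Pi\<^sub>E L D \<Longrightarrow>
      t x = (\<Sum>i<r. g i (restrict x B) * h i (restrict x (L - B)))"
    using assms unfolding sep_rank_le_def by blast
  have "L - (L - B) = B" using assms by blast
  then have "t x = (\<Sum>i<r. h i (restrict x (L - B)) * g i (restrict x (L - (L - B))))"
    if "x \<in> Pi\<^sub>E L D" for x
    using *[OF that] by (simp add: mult.commute)
  then show ?thesis by (intro sep_rank_leI[of "{..<r}" _ _ _ _ h _ g]) simp_all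
qed

lemma sep_rank_le_all: "sep_rank_le L D t L 1"
  by (rule sep_rank_leI[of "{()}" _ _ _ _ "\<lambda>_. t" _ "\<lambda>_ _. 1"])
     simp_all

section \<open>Slices and submultiplicativity\<close>

lemma override_on_PiE:
  "x \<in> Pi\<^sub>E L D \<Longrightarrow> z \<in> Pi\<^sub>E L D \<Longrightarrow> override_on x z B \<in> Pi\<^sub>E L D"
  by (auto simp: override_on_def PiE_iff extensional_def)

text \<open>A matrix of rank at most \<open>r\<close> has at most \<open>r\<close> rows that span
  all its rows. The row of \<open>z\<close> is the slice of \<open>t\<close> with the coordinates in
  \<open>B\<close> frozen to those of \<open>z\<close>, so the right factors become slices of
  \<open>t\<close> itself.\<close>

lemma sep_rank_le_slices:
  assumes "sep_rank_le L D t B r"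
  obtains Z g where "finite Z" "card Z \<le> r" "Z \<subseteq> Pi\<^sub>E L D"
    "\<And>x. x \<in> Pi\<^sub>E L D \<Longrightarrow> t x = (\<Sum>z\<in>Z. g z (restrict x B) * t (override_on x z B))"
proof -
  let ?P = "Pi\<^sub>E L D"
  obtain g h where gh: "\<And>x. x \<in> ?P \<Longrightarrow>
      t x = (\<Sum>i<r. g i (restrict x B) * h i (restrict x (L - B)))"
    using assms unfolding sep_rank_le_def by blast
  \<comment> \<open>Slices and factors are both 0 off \<open>?P\<close>, so the linear relations
    below are equations between functions.\<close>
  define s where "s z x = (if x \<in> ?P then t (override_on x z B) else 0)" for z x
  define H where "H i x = (if x \<in> ?P then h i (restrict x (L - B)) else 0)" for i x
  have s_span: "s z \<in> fs.span (H ` {..<r})" if "z \<in> ?P" for z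
  proof -
    have "s z = (\<Sum>i<r. fun_scale (g i (restrict z B)) (H i))"
    proof
      fix x
      have "restrict (override_on x z B) B = restrict z B"
        "restrict (override_on x z B) (L - B) = restrict x (L - B)"
        by (auto simp: override_on_def restrict_def)
      then show "s z x = (\<Sum>i<r. fun_scale (g i (restrict z B)) (H i)) x"
        using that by (auto simp: sum_fun_app s_def H_def fun_scale_def gh override_on_PiE)
    qed
    also have "\<dots> \<in> fs.span (H ` {..<r})"
      by (rule fs.span_sum, rule fs.span_scale, rule fs.span_base, rule imageI)
    finally show ?thesis .
  qed
  obtain S where S: "S \<subseteq> s ` ?P" "fs.independent S" "s ` ?P \<subseteq> fs.span S"
    by (rule fs.basis_exists[of "s ` ?P"])
  have "S \<subseteq> fs.span (H ` {..<r})" using S(1) s_span by blast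
  from fs.independent_span_bound[OF _ S(2) this]
  have fin: "finite S" and "card S \<le> card (H ` {..<r})" by auto
  then have card: "card S \<le> r" using card_image_le[of "{..<r}" H] by simp
  \<comment> \<open>The basis \<open>S\<close> consists of slices; \<open>k\<close> picks a point
    producing each of them.\<close>
  define k where "k = inv_into ?P s"
  have k: "k b \<in> ?P" "s (k b) = b" if "b \<in> S" for b
    using that S(1) inv_into_into[of b s ?P] f_inv_into_f[of b s ?P] unfolding k_def by blast+
  have inj: "inj_on k S" by (rule inj_on_inverseI[of _ s]) (rule k)
  define c where "c z y = fs.representation S (s y) (s z)" for z y
  \<comment> \<open>A slice depends on its index only through \<open>B\<close>, which makes its
    coordinates functions of \<open>restrict x B\<close>.\<close>
  have s_restrict: "s (restrict x B) = s x" for x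
    unfolding s_def by (rule ext) (auto simp: override_on_def intro!: arg_cong[of _ _ t])
  show thesis
  proof
    show "finite (k ` S)" "card (k ` S) \<le> r" "k ` S \<subseteq> ?P"
      using fin card inj k by (auto simp: card_image)
    fix x assume x: "x \<in> ?P"
    \<comment> \<open>\<open>t x\<close> is the diagonal entry: the slice of \<open>x\<close>
      evaluated at \<open>x\<close>. This slice is then expanded in \<open>S\<close>.\<close>
    have "override_on x x B = x" by (auto simp: override_on_def)
    then have "t x = s x x" using x by (simp add: s_def)
    also have "s x = (\<Sum>b\<in>S. fun_scale (fs.representation S (s x) b) b)"
      by (rule fs.sum_representation_eq[symmetric]) (use S x fin in auto)
    also have "\<dots> x = (\<Sum>b\<in>S. fs.representation S (s x) b * b x)"
      by (simp add: sum_fun_app fun_scale_def)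
    also have "\<dots> = (\<Sum>b\<in>S. fs.representation S (s x) (s (k b)) * s (k b) x)"
      by (simp add: k)
    also have "\<dots> = (\<Sum>b\<in>S. c (k b) (restrict x B) * t (override_on x (k b) B))"
      using x by (simp add: c_def s_restrict) (simp add: s_def)
    also have "\<dots> = (\<Sum>z\<in>k ` S. c z (restrict x B) * t (override_on x z B))"
      by (simp add: sum.reindex[OF inj])
    finally show "t x = (\<Sum>z\<in>k ` S. c z (restrict x B) * t (override_on x z B))" .
  qed
qed

text \<open>Expanding \<open>t\<close> in slices that freeze the coordinates in \<open>B\<close> leaves functions that do not
  depend on these coordinates, so for them \<open>A\<close> may be exchanged with \<open>A'\<close>.\<close>

lemma sep_rank_le_mult:
  assumes B: "sep_rank_le L D t B r" and A': "sep_rank_le L D t A' q"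
    and AA': "A' - B = A - B" and mono: "B \<subseteq> A \<or> B \<subseteq> L - A"
  shows "sep_rank_le L D t A (r * q)"
proof -
  let ?P = "Pi\<^sub>E L D"
  obtain Z g where Z: "finite Z" "card Z \<le> r" "Z \<subseteq> ?P"
    and g: "\<And>x. x \<in> ?P \<Longrightarrow> t x = (\<Sum>z\<in>Z. g z (restrict x B) * t (override_on x z B))"
    using sep_rank_le_slices[OF B] by blast
  obtain u v where uv: "\<And>x. x \<in> ?P \<Longrightarrow>
      t x = (\<Sum>j<q. u j (restrict x A') * v j (restrict x (L - A')))"
    using A' unfolding sep_rank_le_def by blast
  \<comment> \<open>Once \<open>B\<close> is frozen to \<open>z\<close>, only coordinates outside
    \<open>B\<close> are read, and there \<open>A\<close> and \<open>A'\<close> agree. So the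
    factors for \<open>A'\<close> can be computed from the restrictions to \<open>A\<close> and
    \<open>L - A\<close>.\<close>
  define U where "U = (\<lambda>(z, j) y. u j (restrict (override_on y z B) A'))"
  define W where "W = (\<lambda>(z, j) y. v j (restrict (override_on y z B) (L - A')))"
  have exp: "t x = (\<Sum>i\<in>Z \<times> {..<q}. g (fst i) (restrict x B) *
      (U i (restrict x A) * W i (restrict x (L - A))))" if x: "x \<in> ?P" for x
  proof -
    have "restrict (override_on (restrict x A) z B) A' = restrict (override_on x z B) A'"
      "restrict (override_on (restrict x (L - A)) z B) (L - A')
        = restrict (override_on x z B) (L - A')" for z
      using AA' by (auto simp: override_on_def restrict_def fun_eq_iff)
    then have "t (override_on x z B)
        = (\<Sum>j<q. U (z, j) (restrict x A) * W (z, j) (restrict x (L - A)))" if "z \<in> Z" for z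
      using uv[OF override_on_PiE[OF x, of z B]] that Z(3) by (auto simp: U_def W_def)
    then show ?thesis
      unfolding g[OF x] by (simp add: sum_distrib_left sum.cartesian_product case_prod_unfold)
  qed
  have fin: "finite (Z \<times> {..<q})" "card (Z \<times> {..<q}) \<le> r * q" using Z by auto
  \<comment> \<open>The coefficient \<open>g\<close> reads the coordinates in \<open>B\<close>; it
    is absorbed into the factor that sees all of \<open>B\<close>.\<close>
  show ?thesis
    using mono
  proof
    assume "B \<subseteq> A"
    then have "restrict (restrict x A) B = restrict x B" for x :: "'a \<Rightarrow> 'b"
      by (auto simp: restrict_def fun_eq_iff)
    then show ?thesis
      using exp by (intro sep_rank_leI[OF fin, where
        g = "\<lambda>i y. g (fst i) (restrict y B) * U i y" and h = W]) (simp add: mult_ac)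
  next
    assume "B \<subseteq> L - A"
    then have "restrict (restrict x (L - A)) B = restrict x B" for x :: "'a \<Rightarrow> 'b"
      by (auto simp: restrict_def fun_eq_iff)
    then show ?thesis
      using exp by (intro sep_rank_leI[OF fin, where
        g = U and h = "\<lambda>i y. g (fst i) (restrict y B) * W i y"]) (simp add: mult_ac)
  qed
qed

section \<open>Cuts of trees\<close>

lemma component_refl: "v \<in> component E v"
  by (simp add: component_def)

lemma component_step: "w \<in> component E v \<Longrightarrow> {w, w'} \<in> E \<Longrightarrow> w' \<in> component E v"
  unfolding component_def adj_def by (auto intro: rtrancl.rtrancl_into_rtrancl)

lemma component_trans: "w \<in> component E v \<Longrightarrow> u \<in> component E w \<Longrightarrow> u \<in> component E v"
  unfolding component_def by (auto intro: rtrancl_trans)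

lemma component_sym:
  assumes "w \<in> component E v" shows "v \<in> component E w"
proof -
  have "sym (adj E)" unfolding adj_def sym_def by (auto simp: insert_commute)
  then show ?thesis using assms symD[OF sym_rtrancl] unfolding component_def by fast
qed

text \<open>Induction along walks, with the invariant given as a set.\<close>

lemma component_least:
  assumes "w \<in> component E v" "v \<in> S" "\<And>a b. {a, b} \<in> E \<Longrightarrow> a \<in> S \<Longrightarrow> b \<in> S"
  shows "w \<in> S"
proof -
  have "(v, w) \<in> (adj E)\<^sup>*" using assms(1) by (simp add: component_def)
  then show ?thesis
    by (induction rule: rtrancl_induct) (use assms(2,3) in \<open>unfold adj_def, blast+\<close>)
qed

text \<open>A walk between the endpoints that avoids the edge shortens to a path with distinct
  vertices, which the edge closes to a cycle.\<close>

lemma tree_edge_bridge: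
  assumes "is_tree X E" "{u, v} \<in> E"
  shows "v \<notin> component (E - {{u, v}}) u"
proof
  assume v: "v \<in> component (E - {{u, v}}) u"
  let ?r = "\<lambda>a b. {a, b} \<in> E - {{u, v}}"
  have "(u, v) \<in> {(a, b). ?r a b}\<^sup>*" using v by (simp add: component_def adj_def)
  then have "?r\<^sup>*\<^sup>* u v" by (simp add: rtranclp_rtrancl_eq)
  then obtain ys where "rtrancl_path ?r u ys v"
    by (auto simp: rtranclp_eq_rtrancl_path)
  then obtain xs where xs: "rtrancl_path ?r u xs v" "distinct (u # xs)"
    using rtrancl_path_distinct by metis
  have "card {u, v} = 2" using assms unfolding is_tree_def by blast
  then have uv: "u \<noteq> v" by auto
  have ne: "xs \<noteq> []" using xs(1) uv by (auto elim: rtrancl_path.cases)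
  have last: "last xs = v" using rtrancl_path_last[OF xs(1) ne] .
  have edge: "{(u # xs) ! i, xs ! i} \<in> E - {{u, v}}" if "i < length xs" for i
    using rtrancl_path_nth[OF xs(1) that] .
  \<comment> \<open>A single step would be the removed edge itself, so the path has the three
    vertices required by \<open>is_cycle\<close>.\<close>
  have "length xs \<noteq> 1"
  proof
    assume "length xs = 1"
    then have "xs = [v]" using last by (cases xs) auto
    then show False using edge[of 0] by simp
  qed
  moreover have "length xs \<noteq> 0" using ne by simp
  ultimately have len: "3 \<le> length (u # xs)" unfolding list.size by linarith
  \<comment> \<open>At \<open>i = length xs\<close> the successor index wraps to 0, and the edge is
    \<open>{v, u}\<close>.\<close>
  have "{(u # xs) ! i, (u # xs) ! (Suc i mod length (u # xs))} \<in> E" if "i < length (u # xs)" for i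
  proof (cases "i < length xs")
    case True
    then show ?thesis using edge[of i] by simp
  next
    case False
    with that have "i = length xs" by simp
    moreover have "(u # xs) ! length xs = v" using ne last by (simp add: last_conv_nth nth_Cons')
    ultimately show ?thesis using assms(2) by (simp add: insert_commute)
  qed
  then have "is_cycle E (u # xs)" using len xs(2) unfolding is_cycle_def by blast
  then show False using assms(1) unfolding is_tree_def by blast
qed

text \<open>No edge leaves the union of both sides, and the bridge property makes them disjoint.
  Hence choosing the other endpoint of an edge complements its set of leaves.\<close>

lemma tree_sides:
  assumes "is_tree X E" "{u, v} \<in> E"
  shows "X - component (E - {{u, v}}) u = X \<inter> component (E - {{u, v}}) v"
proof -
  let ?c = "component (E - {{u, v}})"
  have "w \<in> ?c u \<union> ?c v" if "w \<in> X" for w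
  proof -
    have "u \<in> X" using assms unfolding is_tree_def by blast
    then have "w \<in> component E u" using assms(1) that unfolding is_tree_def by blast
    then show ?thesis
    proof (rule component_least)
      show "u \<in> ?c u \<union> ?c v" by (simp add: component_refl)
      fix a b assume ab: "{a, b} \<in> E" "a \<in> ?c u \<union> ?c v"
      show "b \<in> ?c u \<union> ?c v"
      proof (cases "{a, b} = {u, v}")
        case True
        then show ?thesis using component_refl by (metis UnCI doubleton_eq_iff)
      next
        case False
        then show ?thesis using ab component_step[of a "E - {{u, v}}" _ b] by blast
      qed
    qed
  qed
  moreover have "w \<notin> ?c v" if "w \<in> ?c u" for w
    using tree_edge_bridge[OF assms] that component_sym component_trans by metis
  ultimately show ?thesis by blast
qed

text \<open>The witness is an edge of \<open>M\<close> with a side of minimal size.\<close>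

lemma extremal_cut_edge:
  assumes tree: "is_tree X E" and M: "M \<subseteq> E" "M \<noteq> {}"
  obtains u v where "{u, v} \<in> M"
    "\<And>e. e \<in> M \<Longrightarrow> e \<subseteq> component (E - {{u, v}}) v \<Longrightarrow> False"
proof -
  have two: "\<exists>a b. e = {a, b}" if "e \<in> E" for e
  proof -
    have "card e = 2" using tree that unfolding is_tree_def by blast
    then show ?thesis by (auto simp: card_2_iff)
  qed
  have inX: "component (E - F) v \<subseteq> X" if "v \<in> X" for v F
  proof
    fix w assume "w \<in> component (E - F) v"
    then show "w \<in> X"
    proof (rule component_least)
      fix a b assume "{a, b} \<in> E - F"
      then show "b \<in> X" using tree unfolding is_tree_def by blast
    qed fact
  qed
  have finX: "finite X" using tree by (simp add: is_tree_def)
  \<comment> \<open>Ordered pairs let both sides of each edge compete for the minimum.\<close>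
  let ?m = "\<lambda>(u, v). card (component (E - {{u, v}}) v)"
  obtain e where e: "e \<in> M" using M by blast
  then obtain a b where "e = {a, b}" using two M by blast
  with e have "\<exists>p. {fst p, snd p} \<in> M" by (metis fst_conv snd_conv)
  from ex_has_least_nat[of "\<lambda>p. {fst p, snd p} \<in> M" _ ?m] this
  obtain u v where uv: "{u, v} \<in> M"
    and min: "\<And>u' v'. {u', v'} \<in> M \<Longrightarrow>
      card (component (E - {{u, v}}) v) \<le> card (component (E - {{u', v'}}) v')"
    by fastforce
  let ?S = "component (E - {{u, v}}) v"
  show thesis
  proof
    show "{u, v} \<in> M" by fact
    fix e' assume e': "e' \<in> M" "e' \<subseteq> ?S"
    \<comment> \<open>\<open>e'\<close> separates its endpoints, so \<open>v\<close> cannot reach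
      both of them without it.\<close>
    have "\<exists>a b. e' = {a, b} \<and> b \<notin> component (E - {e'}) v"
    proof -
      obtain a b where ab: "e' = {a, b}" using two e' M by blast
      have "b \<notin> component (E - {e'}) a"
        using tree_edge_bridge[OF tree, of a b] e' M ab by auto
      then have "b \<notin> component (E - {e'}) v \<or> a \<notin> component (E - {e'}) v"
        using component_sym component_trans by metis
      then show ?thesis using ab by (auto simp: insert_commute)
    qed
    then obtain a b where ab: "e' = {a, b}" and b: "b \<notin> component (E - {e'}) v" by blast
    let ?S' = "component (E - {e'}) b"
    have v: "v \<notin> ?S'" using b component_sym by metis
    have "u \<notin> ?S" using tree_edge_bridge[OF tree, of v u] uv M by (auto simp: insert_commute)
    then have ne: "{u, v} \<noteq> e'" using e' by auto
    then have u: "u \<notin> ?S'"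
      using v component_step[of u "E - {e'}" b v] uv M by blast
    \<comment> \<open>The side \<open>?S'\<close> contains neither \<open>u\<close> nor
      \<open>v\<close>, so a walk inside it never uses \<open>{u, v}\<close> and stays in
      \<open>?S\<close>. Since it misses \<open>v\<close>, it is strictly smaller than
      \<open>?S\<close>, against minimality.\<close>
    have "w \<in> ?S \<inter> ?S'" if "w \<in> ?S'" for w
      using that
    proof (rule component_least)
      show "b \<in> ?S \<inter> ?S'" using e' ab by (auto simp: component_refl)
      fix c d assume cd: "{c, d} \<in> E - {e'}" "c \<in> ?S \<inter> ?S'"
      then have d: "d \<in> ?S'" using component_step by fast
      have "c \<noteq> u" "c \<noteq> v" using cd(2) u v by auto
      then have "{c, d} \<noteq> {u, v}" by (auto simp: doubleton_eq_iff)
      then have "d \<in> ?S" using cd component_step[of c "E - {{u, v}}" v d] by blast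
      with d show "d \<in> ?S \<inter> ?S'" by blast
    qed
    moreover have "v \<in> ?S" by (rule component_refl)
    ultimately have "?S' \<subset> ?S" using v by blast
    moreover have "v \<in> X" using uv M tree unfolding is_tree_def by blast
    then have "finite ?S" using inX finX finite_subset by metis
    ultimately have "card ?S' < card ?S" by (rule psubset_card_mono[rotated])
    then show False using min[of a b] e'(1) ab by auto
  qed
qed

text \<open>\<open>C\<close> colours inner vertices too, which turns monochromaticity into closure
  under uncut edges. It varies in the induction because each removed edge recolours a side; both
  sides carry the bound \<open>f\<close> since either may be the one recoloured.\<close>

lemma sep_rank_le_cut:
  assumes tree: "is_tree X E" and L: "L \<subseteq> X"
    and "finite M" "M \<subseteq> E"
    and "\<And>u v. {u, v} \<in> M \<Longrightarrow> sep_rank_le L D t (L \<inter> component (E - {{u, v}}) v) (f {u, v})"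
    and "\<And>a b. {a, b} \<in> E - M \<Longrightarrow> a \<in> C \<Longrightarrow> b \<in> C"
  shows "sep_rank_le L D t (L \<inter> C) (\<Prod>e\<in>M. f e)"
  using assms(3-)
proof (induction "card M" arbitrary: M C)
  case 0
  have M: "M = {}" using 0(1,2) by simp
  \<comment> \<open>With nothing cut, connectedness leaves a single colour, and the bound is the
    empty product 1.\<close>
  have "X \<subseteq> C \<or> X \<inter> C = {}"
  proof (rule ccontr)
    assume "\<not> ?thesis"
    then obtain x y where xy: "x \<in> X" "x \<in> C" "y \<in> X" "y \<notin> C" by blast
    then have "y \<in> component E x" using tree by (auto simp: is_tree_def)
    then have "y \<in> C"
    proof (rule component_least)
      show "b \<in> C" if "{a, b} \<in> E" "a \<in> C" for a b
        using 0(5)[of a b] that M by blast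
    qed fact
    with xy show False by simp
  qed
  then have "L \<inter> C = L \<or> L \<inter> C = L - L" using L by blast
  moreover have "sep_rank_le L D t (L - L) 1"
    by (intro sep_rank_le_compl sep_rank_le_all) auto
  ultimately show ?case using M sep_rank_le_all[of L D t] by auto
next
  case (Suc n)
  have "M \<noteq> {}" using Suc.hyps(2) by auto
  from extremal_cut_edge[OF tree Suc.prems(2) this]
  obtain u v where uv: "{u, v} \<in> M"
    and ext: "\<And>e. e \<in> M \<Longrightarrow> e \<subseteq> component (E - {{u, v}}) v \<Longrightarrow> False" by metis
  let ?S = "component (E - {{u, v}}) v"
  let ?M = "M - {{u, v}}"
  have C: "a \<in> C \<longleftrightarrow> b \<in> C" if "{a, b} \<in> E - M" for a b
    using Suc.prems(4)[of a b] Suc.prems(4)[of b a] that by (auto simp: insert_commute)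
  have S: "a \<in> ?S \<longleftrightarrow> b \<in> ?S" if "{a, b} \<in> E - {{u, v}}" for a b
    using component_step[of a _ v b] component_step[of b _ v a] that by (auto simp: insert_commute)
  have uS: "u \<notin> ?S"
    using tree_edge_bridge[OF tree, of v u] uv Suc.prems(2) by (auto simp: insert_commute)
  \<comment> \<open>By the choice of \<open>{u, v}\<close> no cut edge lies inside
    \<open>?S\<close>, so the colour is constant along walks there.\<close>
  have "w \<in> {w \<in> ?S. w \<in> C \<longleftrightarrow> v \<in> C}" if "w \<in> ?S" for w
    using that
  proof (rule component_least)
    fix a b
    assume ab: "{a, b} \<in> E - {{u, v}}" "a \<in> {w \<in> ?S. w \<in> C \<longleftrightarrow> v \<in> C}"
    then have "b \<in> ?S" using S[OF ab(1)] by blast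
    moreover from this have "{a, b} \<notin> M" using ext[of "{a, b}"] ab by blast
    ultimately show "b \<in> {w \<in> ?S. w \<in> C \<longleftrightarrow> v \<in> C}" using C[of a b] ab by blast
  qed (simp add: component_refl)
  then have mono: "?S \<subseteq> C \<or> ?S \<inter> C = {}" by blast
  \<comment> \<open>The side of \<open>v\<close> takes the colour of \<open>u\<close>, so
    \<open>{u, v}\<close> no longer separates colours.\<close>
  define C' where "C' = (if u \<in> C then C \<union> ?S else C - ?S)"
  have vS: "v \<in> ?S" by (rule component_refl)
  have "sep_rank_le L D t (L \<inter> C') (\<Prod>e\<in>?M. f e)"
  proof (rule Suc.hyps(1))
    show "n = card ?M" using Suc.hyps(2) uv Suc.prems(1) by simp
    show "finite ?M" "?M \<subseteq> E" using Suc.prems(1,2) by auto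
    show "sep_rank_le L D t (L \<inter> component (E - {{a, b}}) b) (f {a, b})" if "{a, b} \<in> ?M" for a b
      using Suc.prems(3) that by blast
    fix a b assume ab: "{a, b} \<in> E - ?M" "a \<in> C'"
    show "b \<in> C'"
    proof (cases "{a, b} = {u, v}")
      case True
      then show ?thesis using ab(2) uS vS
        by (auto simp: C'_def doubleton_eq_iff split: if_splits)
    next
      case False
      \<comment> \<open>Any other edge lies on one side: inside \<open>?S\<close> the new colour is
        constant, outside it is unchanged.\<close>
      then show ?thesis using ab S[of a b] C[of a b] by (auto simp: C'_def split: if_splits)
    qed
  qed
  moreover have "L \<inter> C' - L \<inter> ?S = L \<inter> C - L \<inter> ?S" by (auto simp: C'_def)
  moreover have "L \<inter> ?S \<subseteq> L \<inter> C \<or> L \<inter> ?S \<subseteq> L - L \<inter> C" using mono by blast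
  ultimately have "sep_rank_le L D t (L \<inter> C) (f {u, v} * (\<Prod>e\<in>?M. f e))"
    by (rule sep_rank_le_mult[OF Suc.prems(3)[OF uv]])
  also have "f {u, v} * (\<Prod>e\<in>?M. f e) = (\<Prod>e\<in>M. f e)"
    using prod.remove[OF Suc.prems(1) uv] by metis
  finally show ?case .
qed

section \<open>Flattening rank as separation rank\<close>

lemma subspace_dual_space: "fs.subspace (dual_space scale S)"
  unfolding fs.subspace_def dual_space_def by (auto simp: fun_scale_def algebra_simps)

text \<open>A functional is linear only on \<open>S\<close>, so the induction keeps every partial
  sum inside \<open>S\<close>.\<close>

lemma dual_space_sum:
  assumes "vector_space sc" and S: "module.subspace sc S" and \<phi>: "\<phi> \<in> dual_space sc S"
    and d: "\<And>b. b \<in> F \<Longrightarrow> d b \<in> S"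
  shows "\<phi> (\<Sum>b\<in>F. sc (c b) (d b)) = (\<Sum>b\<in>F. c b * \<phi> (d b))"
proof -
  interpret vector_space sc by fact
  have add: "\<phi> (x + y) = \<phi> x + \<phi> y" if "x \<in> S" "y \<in> S" for x y
    using \<phi> that by (simp add: dual_space_def)
  have scl: "\<phi> (sc a x) = a * \<phi> x" if "x \<in> S" for a x
    using \<phi> that by (simp add: dual_space_def)
  have zero: "\<phi> 0 = 0" using scl[of 0 0] subspace_0[OF S] by simp
  show ?thesis
    using d
  proof (induction F rule: infinite_finite_induct)
    case (insert b F)
    then have "(\<Sum>b\<in>F. sc (c b) (d b)) \<in> S" "sc (c b) (d b) \<in> S"
      by (auto intro!: subspace_sum[OF S] subspace_scale[OF S])
    then show ?case using insert by (simp add: add scl)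
  qed (simp_all add: zero)
qed

lemma subspace_tensor_space: "fs.subspace (tensor_space scale V K)"
  unfolding fs.subspace_def tensor_space_def by (auto simp: fun_scale_def algebra_simps)

lemma tensor_sum:
  assumes t: "t \<in> tensor_space scale V K" and x: "x \<in> covectors scale V K" and l: "l \<in> K"
    and d: "\<And>b. b \<in> F \<Longrightarrow> d b \<in> dual_space scale (V l)"
  shows "t (x(l := \<Sum>b\<in>F. fun_scale (c b) (d b))) = (\<Sum>b\<in>F. c b * t (x(l := d b)))"
proof -
  note S = subspace_dual_space[of scale "V l"]
  have add: "t (x(l := a + b)) = t (x(l := a)) + t (x(l := b))"
    if "a \<in> dual_space scale (V l)" "b \<in> dual_space scale (V l)" for a b
    using t x l that unfolding tensor_space_def by blast
  have scl: "t (x(l := fun_scale k a)) = k * t (x(l := a))" if "a \<in> dual_space scale (V l)" for k a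
    using t x l that unfolding tensor_space_def by blast
  have zero: "t (x(l := 0)) = 0" using scl[OF fs.subspace_0[OF S], of 0] by simp
  show ?thesis
    using d
  proof (induction F rule: infinite_finite_induct)
    case (insert b F)
    then have "(\<Sum>b\<in>F. fun_scale (c b) (d b)) \<in> dual_space scale (V l)"
      "fun_scale (c b) (d b) \<in> dual_space scale (V l)" "d b \<in> dual_space scale (V l)"
      by (auto intro!: fs.subspace_sum[OF S] fs.subspace_scale[OF S])
    moreover have "t (x(l := \<Sum>b\<in>F. fun_scale (c b) (d b))) = (\<Sum>b\<in>F. c b * t (x(l := d b)))"
      using insert by blast
    ultimately show ?case by (simp only: sum.insert[OF insert.hyps(1,2)] add scl)
  qed (simp_all add: zero)
qed

text \<open>Expanding the covector at \<open>l\<close> in a dual basis and using linearity in that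
  slot gives one product per basis vector.\<close>

lemma tensor_sep_rank_leaf:
  assumes "vector_space scale" "findim_subspace scale (V l)"
    and t: "t \<in> tensor_space scale V K" and l: "l \<in> K"
  shows "\<exists>n. sep_rank_le K (\<lambda>l. dual_space scale (V l)) t {l} n"
proof -
  interpret vector_space scale by fact
  obtain B0 where B0: "finite B0" "span B0 = V l"
    using assms(2) by (auto simp: findim_subspace_def)
  obtain B where B: "B \<subseteq> B0" "independent B" "B0 \<subseteq> span B"
    by (rule maximal_independent_subset[of B0])
  have sB: "span B = V l"
    using B B0 span_mono[of B B0] span_minimal[OF B(3) subspace_span] by auto
  have fB: "finite B" using B(1) B0(1) finite_subset by blast
  have BV: "b \<in> V l" if "b \<in> B" for b using that sB span_base by blast
  have sV: "subspace (V l)" using sB subspace_span by metis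
  \<comment> \<open>The dual basis of \<open>B\<close>, extended by 0 as \<open>dual_space\<close>
    demands.\<close>
  define \<delta> where "\<delta> b x = (if x \<in> V l then representation B x b else 0)" for b x
  have \<delta>: "\<delta> b \<in> dual_space scale (V l)" for b
    unfolding dual_space_def \<delta>_def using B(2) sB sV
    by (auto simp: representation_add representation_scale subspace_add subspace_scale)
  have expand: "a = (\<Sum>b\<in>B. fun_scale (a b) (\<delta> b))" if a: "a \<in> dual_space scale (V l)" for a
  proof
    fix x
    show "a x = (\<Sum>b\<in>B. fun_scale (a b) (\<delta> b)) x"
    proof (cases "x \<in> V l")
      case True
      then have "a x = a (\<Sum>b\<in>B. scale (representation B x b) b)"
        using sum_representation_eq[OF B(2), of x B] fB sB by simp
      also have "\<dots> = (\<Sum>b\<in>B. representation B x b * a b)"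
        by (rule dual_space_sum[OF assms(1) sV a BV])
      finally show ?thesis using True by (simp add: sum_fun_app fun_scale_def \<delta>_def mult.commute)
    next
      case False
      then show ?thesis using a by (simp add: dual_space_def sum_fun_app fun_scale_def \<delta>_def)
    qed
  qed
  have "sep_rank_le K (\<lambda>l. dual_space scale (V l)) t {l} (card B)"
  proof (rule sep_rank_leI[OF fB order_refl, where g = "\<lambda>b y. y l b" and h = "\<lambda>b y. t (y(l := \<delta> b))"])
    fix x assume x: "x \<in> (\<Pi>\<^sub>E l\<in>K. dual_space scale (V l))"
    then have "x l \<in> dual_space scale (V l)" using l by auto
    then have "t x = t (x(l := \<Sum>b\<in>B. fun_scale (x l b) (\<delta> b)))"
      using expand[of "x l"] by simp
    also have "\<dots> = (\<Sum>b\<in>B. x l b * t (x(l := \<delta> b)))"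
      by (rule tensor_sum[OF t _ l \<delta>]) (use x in \<open>simp add: covectors_def\<close>)
    \<comment> \<open>The update at \<open>l\<close> overwrites the coordinate lost by the
      restriction.\<close>
    also have "\<dots> = (\<Sum>b\<in>B. restrict x {l} l b * t ((restrict x (K - {l}))(l := \<delta> b)))"
    proof -
      have "(restrict x (K - {l}))(l := \<delta> b) = x(l := \<delta> b)" for b
        using x by (auto simp: fun_eq_iff PiE_iff extensional_def)
      then show ?thesis by simp
    qed
    finally show "t x = (\<Sum>b\<in>B. restrict x {l} l b * t ((restrict x (K - {l}))(l := \<delta> b)))" .
  qed
  then show ?thesis by blast
qed

text \<open>Leaves are added one at a time. What counts is finiteness: it makes the flattening image
  finite-dimensional, whereas \<open>fs.dim\<close> of an infinite-dimensional space is 0 and would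
  bound nothing.\<close>

lemma tensor_sep_rank_finite:
  assumes "vector_space scale" "\<And>l. l \<in> K \<Longrightarrow> findim_subspace scale (V l)"
    and t: "t \<in> tensor_space scale V K" and "finite B" "B \<subseteq> K"
  shows "\<exists>n. sep_rank_le K (\<lambda>l. dual_space scale (V l)) t B n"
  using assms(4,5)
proof (induction B)
  case empty
  then show ?case using sep_rank_le_compl[OF sep_rank_le_all] by fastforce
next
  case (insert l B)
  then obtain m where "sep_rank_le K (\<lambda>l. dual_space scale (V l)) t B m" by auto
  moreover obtain n where "sep_rank_le K (\<lambda>l. dual_space scale (V l)) t {l} n"
    using tensor_sep_rank_leaf[OF assms(1) _ t, of l] assms(2) insert.prems by auto
  ultimately have "sep_rank_le K (\<lambda>l. dual_space scale (V l)) t (insert l B) (n * m)"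
    by (intro sep_rank_le_mult[of K _ t "{l}" n B m "insert l B"]) auto
  then show ?case by blast
qed

section \<open>Slices as tensors, and comparison of the two ranks\<close>

definition tensor_slice where
  "tensor_slice scale V B t \<phi> =
     (\<lambda>\<chi>. if \<chi> \<in> covectors scale V B then t (override_on \<phi> \<chi> B) else 0)"

text \<open>Dual elements are linear only on the tensor space, so slices must lie there before a
  functional can act term by term.\<close>

lemma tensor_slice_in_tensor_space:
  assumes t: "t \<in> tensor_space scale V K" and B: "B \<subseteq> K"
    and \<phi>: "\<phi> \<in> covectors scale V (K - B)"
  shows "tensor_slice scale V B t \<phi> \<in> tensor_space scale V B"
proof -
  have cov: "override_on \<phi> \<chi> B \<in> covectors scale V K" if "\<chi> \<in> covectors scale V B" for \<chi>
    using \<phi> that B by (auto simp: covectors_def override_on_def PiE_iff extensional_def)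
  have upd: "\<chi>(l := a) \<in> covectors scale V B"
    if "\<chi> \<in> covectors scale V B" "l \<in> B" "a \<in> dual_space scale (V l)" for \<chi> l a
    using that by (auto simp: covectors_def PiE_iff extensional_def)
  have over: "override_on \<phi> (\<chi>(l := a)) B = (override_on \<phi> \<chi> B)(l := a)" if "l \<in> B" for \<chi> l a
    using that by (auto simp: override_on_def)
  note S = subspace_dual_space
  show ?thesis
    unfolding tensor_space_def
  proof (intro CollectI conjI ballI allI impI)
    fix \<chi> l a b
    assume *: "\<chi> \<in> covectors scale V B" "l \<in> B"
      "a \<in> dual_space scale (V l)" "b \<in> dual_space scale (V l)"
    then have "t ((override_on \<phi> \<chi> B)(l := a + b)) =
        t ((override_on \<phi> \<chi> B)(l := a)) + t ((override_on \<phi> \<chi> B)(l := b))"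
      using t cov[of \<chi>] B unfolding tensor_space_def by blast
    then show "tensor_slice scale V B t \<phi> (\<chi>(l := a + b)) =
        tensor_slice scale V B t \<phi> (\<chi>(l := a)) + tensor_slice scale V B t \<phi> (\<chi>(l := b))"
      using * by (simp add: tensor_slice_def upd over fs.subspace_add[OF S])
  next
    fix \<chi> l a c
    assume *: "\<chi> \<in> covectors scale V B" "l \<in> B" "a \<in> dual_space scale (V l)"
    then have "t ((override_on \<phi> \<chi> B)(l := fun_scale c a)) = c * t ((override_on \<phi> \<chi> B)(l := a))"
      using t cov[of \<chi>] B unfolding tensor_space_def by blast
    then show "tensor_slice scale V B t \<phi> (\<chi>(l := fun_scale c a)) =
        c * tensor_slice scale V B t \<phi> (\<chi>(l := a))"
      using * by (simp add: tensor_slice_def upd over fs.subspace_scale[OF S])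
  qed (simp add: tensor_slice_def)
qed

lemma contract_eq:
  "contract scale V K B \<psi> t =
     (\<lambda>\<phi>. if \<phi> \<in> covectors scale V (K - B) then \<psi> (tensor_slice scale V B t \<phi>) else 0)"
  unfolding contract_def tensor_slice_def ..

text \<open>All slices over \<open>B\<close> are combinations of fixed slices \<open>s z\<close>
  with coefficients \<open>g z \<phi>\<close>. Contracting with \<open>\<psi>\<close> replaces
  \<open>s z\<close> by the number \<open>\<psi> (s z)\<close>, so every contraction lies in the
  span of the functions \<open>g z\<close>.\<close>

lemma flattening_image_span:
  assumes sep: "sep_rank_le K (\<lambda>l. dual_space scale (V l)) t B r"
    and t: "t \<in> tensor_space scale V K" and B: "B \<subseteq> K"
  obtains H where "finite H" "card H \<le> r" "flattening_image scale V K B t \<subseteq> fs.span H"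
proof -
  let ?P = "\<Pi>\<^sub>E l\<in>K. dual_space scale (V l)"
  \<comment> \<open>The factors of the given separation need not be multilinear, but slices of
    \<open>t\<close> are. Freezing \<open>K - B\<close> leaves tensors over \<open>B\<close>, to
    which \<open>\<psi>\<close> applies.\<close>
  obtain Z g where Z: "finite Z" "card Z \<le> r" "Z \<subseteq> ?P"
    and g: "\<And>x. x \<in> ?P \<Longrightarrow>
      t x = (\<Sum>z\<in>Z. g z (restrict x (K - B)) * t (override_on x z (K - B)))"
    using sep_rank_le_slices[OF sep_rank_le_compl[OF sep B]] by blast
  define H where "H z \<phi> = (if \<phi> \<in> covectors scale V (K - B) then g z \<phi> else 0)" for z \<phi>
  define s where "s z = tensor_slice scale V B t (restrict z (K - B))" for z
  have s_in: "s z \<in> tensor_space scale V B" if "z \<in> Z" for z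
    unfolding s_def
    by (rule tensor_slice_in_tensor_space[OF t B])
       (use that Z(3) in \<open>auto simp: covectors_def restrict_PiE_iff PiE_iff\<close>)
  have slice: "tensor_slice scale V B t \<phi> = (\<Sum>z\<in>Z. fun_scale (g z \<phi>) (s z))"
    if \<phi>: "\<phi> \<in> covectors scale V (K - B)" for \<phi>
  proof
    fix \<chi>
    show "tensor_slice scale V B t \<phi> \<chi> = (\<Sum>z\<in>Z. fun_scale (g z \<phi>) (s z)) \<chi>"
    proof (cases "\<chi> \<in> covectors scale V B")
      case True
      let ?x = "override_on \<phi> \<chi> B"
      have x: "?x \<in> ?P"
        using \<phi> True B by (auto simp: covectors_def override_on_def PiE_iff extensional_def)
      have "restrict ?x (K - B) = \<phi>"
        using \<phi> by (auto simp: covectors_def override_on_def PiE_iff extensional_def fun_eq_iff)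
      moreover have "override_on ?x z (K - B) = override_on (restrict z (K - B)) \<chi> B"
        if "z \<in> Z" for z
        using \<phi> True B
        by (auto simp: covectors_def override_on_def PiE_iff extensional_def fun_eq_iff)
      ultimately show ?thesis
        using True g[OF x] by (simp add: tensor_slice_def s_def sum_fun_app fun_scale_def)
    next
      case False
      then show ?thesis by (simp add: tensor_slice_def s_def sum_fun_app fun_scale_def)
    qed
  qed
  have "contract scale V K B \<psi> t \<in> fs.span (H ` Z)"
    if \<psi>: "\<psi> \<in> dual_space fun_scale (tensor_space scale V B)" for \<psi>
  proof -
    have "contract scale V K B \<psi> t = (\<Sum>z\<in>Z. fun_scale (\<psi> (s z)) (H z))"
    proof
      fix \<phi>
      show "contract scale V K B \<psi> t \<phi> = (\<Sum>z\<in>Z. fun_scale (\<psi> (s z)) (H z)) \<phi>"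
      proof (cases "\<phi> \<in> covectors scale V (K - B)")
        case True
        then have "contract scale V K B \<psi> t \<phi> = \<psi> (\<Sum>z\<in>Z. fun_scale (g z \<phi>) (s z))"
          by (simp add: contract_eq slice)
        also have "\<dots> = (\<Sum>z\<in>Z. g z \<phi> * \<psi> (s z))"
          by (rule dual_space_sum[OF vector_space_fun_scale subspace_tensor_space \<psi> s_in])
        finally show ?thesis
          using True by (simp add: sum_fun_app fun_scale_def H_def mult.commute)
      next
        case False
        then show ?thesis by (simp add: contract_eq sum_fun_app fun_scale_def H_def)
      qed
    qed
    also have "\<dots> \<in> fs.span (H ` Z)"
      by (rule fs.span_sum, rule fs.span_scale, rule fs.span_base, rule imageI)
    finally show ?thesis .
  qed
  then have "flattening_image scale V K B t \<subseteq> fs.span (H ` Z)"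
    unfolding flattening_image_def by blast
  moreover have "card (H ` Z) \<le> r" using card_image_le[OF Z(1), of H] Z(2) by linarith
  ultimately show thesis using that Z(1) by blast
qed

lemma flattening_rank_le:
  assumes "sep_rank_le K (\<lambda>l. dual_space scale (V l)) t B r"
    and "t \<in> tensor_space scale V K" "B \<subseteq> K"
  shows "flattening_rank scale V K B t \<le> r"
proof -
  obtain H where H: "finite H" "card H \<le> r" "flattening_image scale V K B t \<subseteq> fs.span H"
    by (rule flattening_image_span[OF assms])
  show ?thesis
    unfolding flattening_rank_def using fs.dim_le_card[OF H(3,1)] H(2) by linarith
qed

text \<open>Contractions with evaluation functionals recover the values of \<open>t\<close>;
  expanding them in a basis of the flattening image separates \<open>t\<close>. The bound
  \<open>n\<close> ensures that this basis is finite.\<close>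

lemma sep_rank_le_flattening_rank:
  assumes sep: "sep_rank_le K (\<lambda>l. dual_space scale (V l)) t B n"
    and t: "t \<in> tensor_space scale V K" and B: "B \<subseteq> K"
  shows "sep_rank_le K (\<lambda>l. dual_space scale (V l)) t B (flattening_rank scale V K B t)"
proof -
  let ?I = "flattening_image scale V K B t"
  obtain H where H: "finite H" "?I \<subseteq> fs.span H"
    by (rule flattening_image_span[OF assms])
  obtain S where S: "S \<subseteq> ?I" "fs.independent S" "?I \<subseteq> fs.span S" "card S = fs.dim ?I"
    by (rule fs.basis_exists[of ?I])
  have "S \<subseteq> fs.span H" using S(1) H(2) by blast
  then have fS: "finite S" using fs.independent_span_bound[OF H(1) S(2)] by blast
  define ev where "ev \<chi> = (\<lambda>t'. if t' \<in> tensor_space scale V B then t' \<chi> else 0)"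
    for \<chi> :: "'a \<Rightarrow> 'b \<Rightarrow> complex"
  note TS = subspace_tensor_space[of scale V B]
  have ev: "ev \<chi> \<in> dual_space fun_scale (tensor_space scale V B)" for \<chi>
    unfolding dual_space_def ev_def
    by (auto simp: fs.subspace_add[OF TS] fs.subspace_scale[OF TS]) (simp add: fun_scale_def)
  define e where "e \<chi> = contract scale V K B (ev \<chi>) t" for \<chi>
  have e: "e \<chi> \<in> fs.span S" for \<chi>
    using S(3) ev unfolding e_def flattening_image_def by blast
  show ?thesis
  \<comment> \<open>The coordinates depend only on the covectors in \<open>B\<close>, the basis
    functions only on the others.\<close>
  proof (rule sep_rank_leI[OF fS, where g = "\<lambda>b \<chi>. fs.representation S (e \<chi>) b" and h = "\<lambda>b. b"])
    show "card S \<le> flattening_rank scale V K B t"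
      using S(4) by (simp add: flattening_rank_def)
    fix x assume x: "x \<in> (\<Pi>\<^sub>E l\<in>K. dual_space scale (V l))"
    let ?\<phi> = "restrict x (K - B)" and ?\<chi> = "restrict x B"
    have \<phi>: "?\<phi> \<in> covectors scale V (K - B)" and \<chi>: "?\<chi> \<in> covectors scale V B"
      using x B by (auto simp: covectors_def PiE_iff)
    have "override_on ?\<phi> ?\<chi> B = x"
      using x B by (auto simp: override_on_def PiE_iff extensional_def fun_eq_iff)
    then have "t x = e ?\<chi> ?\<phi>"
      using \<phi> \<chi> tensor_slice_in_tensor_space[OF t B \<phi>]
      by (simp add: e_def contract_eq ev_def) (simp add: tensor_slice_def)
    also have "e ?\<chi> = (\<Sum>b\<in>S. fun_scale (fs.representation S (e ?\<chi>) b) b)"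
      by (rule fs.sum_representation_eq[symmetric]) (use S e fS in auto)
    also have "\<dots> ?\<phi> = (\<Sum>b\<in>S. fs.representation S (e ?\<chi>) b * b ?\<phi>)"
      by (simp add: sum_fun_app fun_scale_def)
    finally show "t x = (\<Sum>b\<in>S. fs.representation S (e ?\<chi>) b * b ?\<phi>)" .
  qed
qed

section \<open>The bound for a monochromatic cut\<close>

theorem mainTheorem2:
  fixes scale :: "complex \<Rightarrow> 'v::ab_group_add \<Rightarrow> 'v"
    and V :: "'a \<Rightarrow> 'v set"
    and X :: "'a set" and E :: "'a set set"
    and tail :: "'a set \<Rightarrow> 'a" and f :: "'a set \<Rightarrow> nat"
    and A :: "'a set" and M :: "'a set set"
    and t :: "('a, 'v) tensor"
  assumes "binary_tree X E"
    and "vector_space scale"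
    and "\<And>l. l \<in> leaves X E \<Longrightarrow> findim_subspace scale (V l)"
    and "\<And>e. e \<in> E \<Longrightarrow> tail e \<in> e"
    and "A \<subseteq> leaves X E"
    and "monochromatic_cut X E A M"
    and "t \<in> TNS scale V X E tail f"
  shows "flattening_rank scale V (leaves X E) A t \<le> (\<Prod>e\<in>M. f e)"
proof -
  let ?L = "leaves X E" and ?D = "\<lambda>l. dual_space scale (V l)"
  have tree: "is_tree X E" using assms(1) by (simp add: binary_tree_def)
  have L: "?L \<subseteq> X" by (auto simp: leaves_def)
  have finX: "finite X" using tree by (simp add: is_tree_def)
  have finL: "finite ?L" using L finX finite_subset by blast
  have t: "t \<in> tensor_space scale V ?L" using assms(7) by (simp add: TNS_def)
  have ME: "M \<subseteq> E" using assms(6) by (simp add: monochromatic_cut_def)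
  have "E \<subseteq> Pow X" using tree by (auto simp: is_tree_def)
  then have finM: "finite M" using ME finX by (meson finite_Pow_iff finite_subset)
  have side: "sep_rank_le ?L ?D t (side_leaves X E e (tail e)) (f e)" if e: "e \<in> E" for e
  proof -
    let ?B = "side_leaves X E e (tail e)"
    have B: "?B \<subseteq> ?L" by (auto simp: side_leaves_def)
    then obtain n where "sep_rank_le ?L ?D t ?B n"
      using tensor_sep_rank_finite[OF assms(2,3) t finite_subset[OF B finL]] by blast
    from sep_rank_le_flattening_rank[OF this t B] show ?thesis
      by (rule sep_rank_le_mono) (use assms(7) e in \<open>auto simp: TNS_def\<close>)
  qed
  \<comment> \<open>\<open>tail\<close> fixes one side of each edge; the other side inherits the
    bound as its complement in the leaves.\<close>
  have sides: "sep_rank_le ?L ?D t (?L \<inter> component (E - {{u, v}}) v) (f {u, v})"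
    if uv: "{u, v} \<in> M" for u v
  proof -
    have uvE: "{u, v} \<in> E" using uv ME by blast
    have "?L - side_leaves X E {u, v} u = ?L \<inter> component (E - {{u, v}}) v"
      using tree_sides[OF tree uvE] L unfolding side_leaves_def by blast
    moreover have "tail {u, v} = u \<or> tail {u, v} = v" using assms(4)[OF uvE] by auto
    moreover have "side_leaves X E {u, v} u \<subseteq> ?L" by (auto simp: side_leaves_def)
    ultimately show ?thesis
      using side[OF uvE] sep_rank_le_compl[of ?L ?D t "side_leaves X E {u, v} u"]
      by (auto simp: side_leaves_def)
  qed
  \<comment> \<open>The vertices joined to \<open>A\<close> without crossing the cut;
    monochromaticity ensures that no leaf outside \<open>A\<close> is among them.\<close>
  define C where "C = (\<Union>l\<in>A. component (E - M) l)"
  have "?L \<inter> C = A"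
  proof (intro equalityI subsetI)
    fix w assume "w \<in> ?L \<inter> C"
    then obtain l where l: "l \<in> A" "w \<in> component (E - M) l" "w \<in> ?L" by (auto simp: C_def)
    then have "?L \<inter> component (E - M) l \<subseteq> A"
      using assms(5,6) L component_refl[of l "E - M"] unfolding monochromatic_cut_def by blast
    then show "w \<in> A" using l by blast
  next
    fix w assume "w \<in> A"
    then show "w \<in> ?L \<inter> C" using assms(5) component_refl by (fastforce simp: C_def)
  qed
  moreover have "sep_rank_le ?L ?D t (?L \<inter> C) (\<Prod>e\<in>M. f e)"
    by (rule sep_rank_le_cut[OF tree L finM ME sides])
       (auto simp: C_def intro: component_step)
  ultimately show ?thesis using flattening_rank_le[OF _ t assms(5)] by simp
qed

end
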